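(* For $\alpha\ge 0$ let $F_\alpha(x)=\dfrac{\Gamma(x+\alpha)}{x^\alpha\,\Gamma(x)}$, $x>0$. Then $F_\alpha$ is a Bernstein function on $(0,\infty)$ if and only if $0\le\alpha\le 1$.
   Context: A function $f:(0,\infty)\to[0,\infty)$ is completely monotone if $f\in C^\infty$ and $(-1)^n f^{(n)}(x)\ge 0$ for all $n\ge 0$, $x>0$. A function $g:(0,\infty)\to[0,\infty)$ is a Bernstein function if $g\in C^\infty$ and $g'$ is completely monotone. *)

theory Defs
  imports "HOL-Analysis.Analysis"
begin

text \<open>
  Functions on the open half-line are represented by total functions on the reals of which only
  the values at positive arguments matter. As the half-line is open, \<^const>\<open>deriv\<close> at
  a positive point depends only on those values.
\<close>

definition smooth_pos :: "(real \<Rightarrow> real) \<Rightarrow> bool" where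
  "smooth_pos f \<longleftrightarrow> (\<forall>n. (deriv ^^ n) f differentiable_on {0<..})"

definition completely_monotone :: "(real \<Rightarrow> real) \<Rightarrow> bool" where
  "completely_monotone f \<longleftrightarrow>
     f ` {0<..} \<subseteq> {0..} \<and> smooth_pos f \<and>
     (\<forall>n. \<forall>x>0. (-1) ^ n * (deriv ^^ n) f x \<ge> 0)"

definition bernstein_function :: "(real \<Rightarrow> real) \<Rightarrow> bool" where
  "bernstein_function g \<longleftrightarrow>
     g ` {0<..} \<subseteq> {0..} \<and> smooth_pos g \<and> completely_monotone (deriv g)"

definition gamma_ratio :: "real \<Rightarrow> real \<Rightarrow> real" where
  "gamma_ratio \<alpha> x = Gamma (x + \<alpha>) / (x powr \<alpha> * Gamma x)"

end

theory Submission
  imports Defs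
begin

text \<open>
  For \<open>0 < \<alpha> < 1\<close> the ratio \<open>F\<^sub>\<alpha> x\<close> is \<open>x\<close> times the Laplace transform, at \<open>x\<close>, of a bounded,
  nonnegative, decreasing kernel \<open>k\<close> on the half-line, and every function of that shape is a
  Bernstein function (\<open>bernstein_functionI_laplace\<close>).

  The representation arises by writing \<open>F\<^sub>\<alpha> x / x\<close> as the product of \<open>x powr (- \<alpha>)\<close> and
  \<open>Gamma (x + \<alpha>) / Gamma (x + 1)\<close>. Up to constants these are the Laplace transforms of
  \<open>t powr (\<alpha> - 1)\<close> (a Gamma integral) and of \<open>(exp s - 1) powr (- \<alpha>)\<close> (a Beta integral), so \<open>k\<close>
  is a multiple of their convolution. That the convolution decreases becomes clear after scaling
  the integration variable to the unit interval: \<open>k t\<close> is then the average of \<open>\<phi> (t * u)\<close> over a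
  Beta distribution in \<open>u\<close>, where \<open>\<phi> s = (s / (exp s - 1)) powr \<alpha>\<close> is decreasing
  (\<open>ratio_kernel_antimono\<close>, \<open>Gamma_integral_product_eq_laplace\<close>). The logarithmic
  derivative of \<open>F\<^sub>\<alpha>\<close> is also completely monotone in this range, but that alone would not
  suffice: exponentiation does not preserve complete monotonicity of the derivative.

  For \<open>\<alpha> = 0\<close> and \<open>\<alpha> = 1\<close> the ratio is the constant one. For \<open>\<alpha> > 1\<close> it tends to infinity at
  zero (\<open>gamma_ratio_at_right_0\<close>), whereas a Bernstein function is increasing and hence bounded
  near zero.
\<close>

section \<open>Laplace transforms of monotone kernels\<close>

lemma nn_integral_powr_exp:
  fixes a x :: real
  assumes "a > 0" "x > 0"
  shows "(\<integral>\<^sup>+t. ennreal (indicator {0<..} t * (t powr (a - 1) * exp (- (x * t)))) \<partial>lborel)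
           = ennreal (Gamma a / x powr a)"
proof -
  let ?f = "\<lambda>t::real. ennreal (indicator {0..} t * t powr (a - 1) / exp t)"
  let ?I = "\<integral>\<^sup>+t. ennreal (indicator {0<..} t * (t powr (a - 1) * exp (- (x * t)))) \<partial>lborel"
  have "ennreal (Gamma a) = (\<integral>\<^sup>+t. ?f t \<partial>lborel)"
    using Gamma_conv_nn_integral_real[OF assms(1)] by simp
  also have "\<dots> = ennreal \<bar>x\<bar> * (\<integral>\<^sup>+t. ?f (0 + x * t) \<partial>lborel)"
    using assms by (intro nn_integral_real_affine) auto
  also have "(\<integral>\<^sup>+t. ?f (0 + x * t) \<partial>lborel) = (\<integral>\<^sup>+t. ennreal (x powr (a - 1)) *
      ennreal (indicator {0<..} t * (t powr (a - 1) * exp (- (x * t)))) \<partial>lborel)"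
    using assms
    by (intro nn_integral_cong)
       (auto simp: indicator_def powr_mult exp_minus divide_inverse zero_le_mult_iff mult_ac
             simp flip: ennreal_mult')
  also have "\<dots> = ennreal (x powr (a - 1)) * ?I"
    by (subst nn_integral_cmult) auto
  also have "ennreal \<bar>x\<bar> * (ennreal (x powr (a - 1)) * ?I) = ennreal (x powr a) * ?I"
    using assms by (simp add: mult.assoc[symmetric] ennreal_mult'[symmetric] powr_mult_base)
  finally have "ennreal (Gamma a) = ennreal (x powr a) * ?I" .
  hence "ennreal (inverse (x powr a)) * ennreal (Gamma a)
           = ennreal (inverse (x powr a)) * ennreal (x powr a) * ?I"
    by (simp add: mult.assoc)
  thus ?thesis
    using assms by (simp add: ennreal_mult'[symmetric] divide_inverse mult.commute)
qed

lemma has_bochner_integral_power_exp: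
  fixes x :: real
  assumes "x > 0"
  shows "has_bochner_integral lborel (\<lambda>t. indicator {0<..} t * (t ^ n * exp (- (x * t))))
           (fact n / x ^ Suc n)"
proof (rule has_bochner_integral_nn_integral)
  have "(\<integral>\<^sup>+t. ennreal (indicator {0<..} t * (t ^ n * exp (- (x * t)))) \<partial>lborel)
      = (\<integral>\<^sup>+t. ennreal (indicator {0<..} t * (t powr (real (Suc n) - 1) * exp (- (x * t)))) \<partial>lborel)"
    by (intro nn_integral_cong) (auto simp: indicator_def powr_realpow)
  also have "\<dots> = ennreal (Gamma (real (Suc n)) / x powr real (Suc n))"
    using assms by (intro nn_integral_powr_exp) auto
  also have "Gamma (real (Suc n)) / x powr real (Suc n) = fact n / x ^ Suc n"
    using assms Gamma_fact[of n, where ?'a = real] powr_realpow[of x "Suc n"]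
    by (simp del: power_Suc add: add.commute)
  finally show "(\<integral>\<^sup>+t. ennreal (indicator {0<..} t * (t ^ n * exp (- (x * t)))) \<partial>lborel)
      = ennreal (fact n / x ^ Suc n)" .
qed (use assms in \<open>auto simp: indicator_def\<close>)

definition laplace_moment :: "(real \<Rightarrow> real) \<Rightarrow> nat \<Rightarrow> real \<Rightarrow> real" where
  "laplace_moment k n x = (\<integral>t. indicator {0<..} t * (t ^ n * exp (- (x * t)) * k t) \<partial>lborel)"

lemma integrable_laplace_moment:
  fixes k :: "real \<Rightarrow> real"
  assumes [measurable]: "k \<in> borel_measurable borel"
    and bound: "\<And>t. t > 0 \<Longrightarrow> \<bar>k t\<bar> \<le> B" and "x > 0"
  shows "integrable lborel (\<lambda>t. indicator {0<..} t * (t ^ n * exp (- (x * t)) * k t))"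
proof (rule Bochner_Integration.integrable_bound)
  show "integrable lborel (\<lambda>t. indicator {0<..} t * (t ^ n * exp (- (x * t))) * B)"
    using has_bochner_integral_power_exp[OF \<open>x > 0\<close>, of n]
    by (intro integrable_mult_left) (auto simp: has_bochner_integral_iff)
  have "\<bar>k t\<bar> \<le> \<bar>B\<bar>" if "t > 0" for t using bound[OF that] by linarith
  thus "AE t in lborel. norm (indicator {0<..} t * (t ^ n * exp (- (x * t)) * k t))
          \<le> norm (indicator {0<..} t * (t ^ n * exp (- (x * t))) * B)"
    by (intro AE_I2) (auto simp: indicator_def abs_mult intro!: mult_left_mono)
qed measurable

lemma abs_exp_minus_one_le:
  fixes z :: real
  shows "\<bar>exp z - 1\<bar> \<le> \<bar>z\<bar> * exp \<bar>z\<bar>"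
proof (cases "z \<ge> 0")
  case True
  have "(1 - z) * exp z \<le> exp (- z) * exp z"
    using exp_ge_add_one_self[of "- z"] by (intro mult_right_mono) auto
  thus ?thesis using True by (simp add: exp_minus algebra_simps)
next
  case False
  have "1 - exp z \<le> - z" using exp_ge_add_one_self[of z] by linarith
  also have "\<dots> \<le> (- z) * exp (- z)" using False by (intro mult_le_cancel_left1[THEN iffD2]) auto
  finally show ?thesis using False by simp
qed

text \<open>
  Differentiation under the integral sign, by dominated convergence: for \<open>\<bar>h\<bar> < x / 2\<close> the
  difference quotients are dominated by \<open>B * t ^ Suc n * exp (- (x / 2 * t))\<close>, half of the decay
  rate \<open>x\<close> being sacrificed to absorb the factor \<open>exp (\<bar>h\<bar> * t)\<close>.
\<close>

lemma laplace_moment_has_derivative: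
  fixes k :: "real \<Rightarrow> real"
  assumes k [measurable]: "k \<in> borel_measurable borel"
    and bound: "\<And>t. t > 0 \<Longrightarrow> \<bar>k t\<bar> \<le> B" and x: "x > 0"
  shows "(laplace_moment k n has_real_derivative - laplace_moment k (Suc n) x) (at x)"
proof -
  let ?L = "laplace_moment k"
  let ?i = "\<lambda>n x t. indicator {0<..} t * (t ^ n * exp (- (x * t)) * k t)"
  have "((\<lambda>h. (?L n (x + h) - ?L n x) / h) \<longlongrightarrow> - ?L (Suc n) x) (at 0)"
    unfolding tendsto_at_iff_sequentially comp_def
  proof (intro allI impI)
    fix h :: "nat \<Rightarrow> real"
    assume h0: "\<forall>i. h i \<in> UNIV - {0}" and h: "h \<longlonglongrightarrow> 0"
    have "eventually (\<lambda>i. \<bar>h i\<bar> < x / 2) sequentially"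
      using tendstoD[OF h, of "x / 2"] x by (simp add: dist_real_def)
    then obtain N where N: "\<And>i. i \<ge> N \<Longrightarrow> \<bar>h i\<bar> < x / 2"
      by (auto simp: eventually_sequentially)
    \<comment> \<open>The shift by \<open>N\<close> makes the domination hold for every term of the sequence.\<close>
    define q where "q = (\<lambda>i t. (?i n (x + h (i + N)) t - ?i n x t) / h (i + N))"
    have q_eq: "integral\<^sup>L lborel (q i) = (?L n (x + h (i + N)) - ?L n x) / h (i + N)" for i
    proof -
      have "x + h (i + N) > 0" using N[of "i + N"] x by auto
      thus ?thesis unfolding q_def laplace_moment_def
        using integrable_laplace_moment[OF k bound, of _ n] x
        by simp
    qed
    have "(\<lambda>i. integral\<^sup>L lborel (q i)) \<longlonglongrightarrow> integral\<^sup>L lborel (\<lambda>t. - ?i (Suc n) x t)"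
    proof (rule integral_dominated_convergence)
      show "integrable lborel (\<lambda>t. indicator {0<..} t * (t ^ Suc n * exp (- (x / 2 * t))) * B)"
        using has_bochner_integral_power_exp[of "x / 2" "Suc n"] x
        by (intro integrable_mult_left) (auto simp: has_bochner_integral_iff)
      show "AE t in lborel. (\<lambda>i. q i t) \<longlonglongrightarrow> - ?i (Suc n) x t"
      proof (rule AE_I2)
        fix t :: real
        have "((\<lambda>y. ?i n y t) has_real_derivative - ?i (Suc n) x t) (at x)"
          by (auto intro!: derivative_eq_intros)
        hence "((\<lambda>h. (?i n (x + h) t - ?i n x t) / h) \<longlongrightarrow> - ?i (Suc n) x t) (at 0)"
          by (simp only: DERIV_def)
        hence "(\<lambda>i. (?i n (x + h i) t - ?i n x t) / h i) \<longlonglongrightarrow> - ?i (Suc n) x t"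
          using h0 h unfolding tendsto_at_iff_sequentially comp_def by blast
        thus "(\<lambda>i. q i t) \<longlonglongrightarrow> - ?i (Suc n) x t"
          unfolding q_def by (rule LIMSEQ_ignore_initial_segment)
      qed
      show "AE t in lborel. norm (q i t) \<le> indicator {0<..} t * (t ^ Suc n * exp (- (x / 2 * t))) * B" for i
      proof (rule AE_I2)
        fix t :: real
        let ?h = "h (i + N)"
        have h_ne: "?h \<noteq> 0" using h0 by auto
        show "norm (q i t) \<le> indicator {0<..} t * (t ^ Suc n * exp (- (x / 2 * t))) * B"
        proof (cases "t > 0")
          case t: True
          have "\<bar>exp (- (?h * t)) - 1\<bar> \<le> \<bar>?h\<bar> * t * exp (\<bar>?h\<bar> * t)"
            using abs_exp_minus_one_le[of "- (?h * t)"] t by (simp add: abs_mult)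
          also have "\<dots> \<le> \<bar>?h\<bar> * t * exp (x / 2 * t)"
            using t N[of "i + N"] by (intro mult_left_mono) auto
          finally have e: "\<bar>exp (- (?h * t)) - 1\<bar> / \<bar>?h\<bar> \<le> t * exp (x / 2 * t)"
            using h_ne by (simp add: field_simps)
          have "q i t = t ^ n * exp (- (x * t)) * k t * ((exp (- (?h * t)) - 1) / ?h)"
            using t by (simp add: q_def algebra_simps exp_add exp_diff exp_minus divide_simps)
          hence "norm (q i t) = t ^ n * exp (- (x * t)) * \<bar>k t\<bar> * (\<bar>exp (- (?h * t)) - 1\<bar> / \<bar>?h\<bar>)"
            using t by (simp add: abs_mult)
          also have "\<dots> \<le> t ^ n * exp (- (x * t)) * B * (t * exp (x / 2 * t))"
            using t bound[OF t] e by (intro mult_mono) auto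
          also have "\<dots> = t ^ Suc n * (exp (- (x * t)) * exp (x / 2 * t)) * B"
            by (simp add: algebra_simps)
          also have "exp (- (x * t)) * exp (x / 2 * t) = exp (- (x / 2 * t))"
            by (simp flip: exp_add)
          finally show ?thesis using t by simp
        qed (simp add: q_def)
      qed
    qed (simp_all add: q_def)
    hence "(\<lambda>i. (?L n (x + h (i + N)) - ?L n x) / h (i + N)) \<longlonglongrightarrow> - ?L (Suc n) x"
      unfolding q_eq by (simp add: laplace_moment_def)
    thus "(\<lambda>i. (?L n (x + h i) - ?L n x) / h i) \<longlonglongrightarrow> - ?L (Suc n) x"
      by (rule LIMSEQ_offset)
  qed
  thus ?thesis by (simp add: DERIV_def)
qed

text \<open>
  With \<open>p t = t ^ Suc n * exp (- (x * t))\<close> the left-hand side is the integral of \<open>p' t * k t\<close> over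
  the half-line. The function \<open>p\<close> vanishes at both ends, so \<open>p'\<close> has integral zero, and a constant
  may be subtracted from \<open>k\<close>. As \<open>p'\<close> changes sign, from positive to negative, only at
  \<open>Suc n / x\<close>, subtracting the value of \<open>k\<close> there makes the integrand nonnegative everywhere. This
  takes the place of an integration by parts, for which \<open>k\<close> would have to be differentiable.
\<close>

lemma laplace_of_antimono_kernel:
  fixes k :: "real \<Rightarrow> real"
  assumes k [measurable]: "k \<in> borel_measurable borel"
    and bound: "\<And>t. t > 0 \<Longrightarrow> \<bar>k t\<bar> \<le> B" and x: "x > 0"
    and anti: "antimono_on {0<..} k"
  shows "real (Suc n) * laplace_moment k n x - x * laplace_moment k (Suc n) x \<ge> 0"
proof -
  define c where "c = k (real (Suc n) / x)"
  let ?i = "\<lambda>n t. indicator {0<..} t * (t ^ n * exp (- (x * t)) * k t)"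
  let ?j = "\<lambda>n t. indicator {0<..} t * (t ^ n * exp (- (x * t)))"
  note int_k = integrable_laplace_moment[OF k bound x]
  note int_1 = has_bochner_integral_power_exp[OF x, unfolded has_bochner_integral_iff]
  have "0 \<le> (\<integral>t. (real (Suc n) * ?i n t - x * ?i (Suc n) t)
               - c * (real (Suc n) * ?j n t - x * ?j (Suc n) t) \<partial>lborel)"
  proof (rule integral_nonneg_AE, rule AE_I2)
    fix t :: real
    show "0 \<le> (real (Suc n) * ?i n t - x * ?i (Suc n) t)
               - c * (real (Suc n) * ?j n t - x * ?j (Suc n) t)"
    proof (cases "t > 0")
      case t: True
      have "0 \<le> (real (Suc n) - x * t) * (k t - c)"
      proof (cases "t \<le> real (Suc n) / x")
        case True
        have "c \<le> k t" unfolding c_def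
          using t x True by (intro monotone_onD[OF anti]) (auto intro: divide_pos_pos)
        thus ?thesis using True x by (intro mult_nonneg_nonneg) (auto simp: field_simps)
      next
        case False
        have "k t \<le> c" unfolding c_def
          using t x False by (intro monotone_onD[OF anti]) (auto intro: divide_pos_pos)
        thus ?thesis using False x by (intro mult_nonpos_nonpos) (auto simp: field_simps)
      qed
      hence "0 \<le> t ^ n * exp (- (x * t)) * ((real (Suc n) - x * t) * (k t - c))"
        using t by (intro mult_nonneg_nonneg[OF _ \<open>0 \<le> (real (Suc n) - x * t) * (k t - c)\<close>]) auto
      also have "\<dots> = (real (Suc n) * ?i n t - x * ?i (Suc n) t)
               - c * (real (Suc n) * ?j n t - x * ?j (Suc n) t)"
        using t by (simp add: algebra_simps)
      finally show ?thesis .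
    qed simp
  qed
  also have "\<dots> = (real (Suc n) * laplace_moment k n x - x * laplace_moment k (Suc n) x)
      - c * (real (Suc n) * (fact n / x ^ Suc n) - x * (fact (Suc n) / x ^ Suc (Suc n)))"
    unfolding laplace_moment_def using int_k int_1
    by (simp del: power_Suc of_nat_Suc fact_Suc)
  also have "real (Suc n) * (fact n / x ^ Suc n) - x * (fact (Suc n) / x ^ Suc (Suc n)) = 0"
    using x by (simp add: field_simps)
  finally show ?thesis by simp
qed

text \<open>
  Leibniz' rule for the product with \<open>x\<close>. At \<open>n = 0\<close> the index \<open>n - 1\<close> truncates to \<open>0\<close>, but that
  term then has the coefficient zero.
\<close>

lemma higher_deriv_times_laplace:
  fixes k F :: "real \<Rightarrow> real"
  assumes k: "k \<in> borel_measurable borel"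
    and bound: "\<And>t. t > 0 \<Longrightarrow> \<bar>k t\<bar> \<le> B"
    and F: "\<And>x. x > 0 \<Longrightarrow> F x = x * laplace_moment k 0 x" and x: "x > 0"
  shows "(deriv ^^ n) F x
           = (-1) ^ n * (x * laplace_moment k n x - real n * laplace_moment k (n - 1) x)"
    and "(deriv ^^ n) F field_differentiable (at x)"
proof -
  let ?L = "laplace_moment k"
  let ?G = "\<lambda>n x. (-1) ^ n * (x * ?L n x - real n * ?L (n - 1) x)"
  have der: "(?G n has_real_derivative ?G (Suc n) x) (at x)" if "x > 0" for n x
  proof -
    have "((\<lambda>x. real n * ?L (n - 1) x) has_real_derivative - (real n * ?L n x)) (at x)"
      using DERIV_cmult[OF laplace_moment_has_derivative[OF k bound that, of "n - 1"], of "real n"]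
      by (cases n) auto
    from DERIV_cmult[OF DERIV_diff[OF DERIV_mult[OF DERIV_ident
           laplace_moment_has_derivative[OF k bound that]] this], of "(-1) ^ n" n]
    show ?thesis by (simp add: algebra_simps)
  qed
  have *: "(deriv ^^ n) F x = ?G n x \<and> ((deriv ^^ n) F has_real_derivative ?G (Suc n) x) (at x)"
    if "x > 0" for x n
    using that
  proof (induction n arbitrary: x)
    case 0
    have "(F has_real_derivative ?G (Suc 0) x) (at x)"
      by (rule has_field_derivative_transform_within_open[OF der[OF 0, of 0], of "{0<..}"])
         (use 0 F in auto)
    thus ?case using F[OF 0] by simp
  next
    case (Suc n)
    have eq: "(deriv ^^ Suc n) F y = ?G (Suc n) y" if "y > 0" for y
      using Suc.IH[OF that] by (auto intro: DERIV_imp_deriv)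
    have "((deriv ^^ Suc n) F has_real_derivative ?G (Suc (Suc n)) x) (at x)"
      by (rule has_field_derivative_transform_within_open[OF der[OF Suc.prems, of "Suc n"], of "{0<..}"])
         (use Suc.prems eq in auto)
    thus ?case using eq[OF Suc.prems] by blast
  qed
  from *[OF x] show "(deriv ^^ n) F x = ?G n x" "(deriv ^^ n) F field_differentiable (at x)"
    by (auto simp: field_differentiable_def)
qed

text \<open>
  Up to sign, each derivative of \<open>F\<close> is one of the nonnegative integrals above. In other words,
  \<open>F\<close> is a mixture of the functions \<open>x \<mapsto> 1 - exp (- (c * x))\<close>: each of them arises from the
  indicator of \<open>{0<..<c}\<close> as \<open>k\<close>, and a decreasing \<open>k\<close> is a mixture of such indicators, with the
  constant function as the limiting case \<open>c = \<infinity>\<close>.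
\<close>

lemma bernstein_functionI_laplace:
  fixes k F :: "real \<Rightarrow> real"
  assumes k: "k \<in> borel_measurable borel"
    and nonneg: "\<And>t. t > 0 \<Longrightarrow> 0 \<le> k t"
    and bound: "\<And>t. t > 0 \<Longrightarrow> k t \<le> B"
    and anti: "antimono_on {0<..} k"
    and F: "\<And>x. x > 0 \<Longrightarrow> F x = x * laplace_moment k 0 x"
  shows "bernstein_function F"
proof -
  have bound': "\<bar>k t\<bar> \<le> B" if "t > 0" for t
    using nonneg[OF that] bound[OF that] by simp
  have deriv: "(deriv ^^ n) F x
      = (-1) ^ n * (x * laplace_moment k n x - real n * laplace_moment k (n - 1) x)"
    "(deriv ^^ n) F field_differentiable (at x)" if "x > 0" for n x
    using higher_deriv_times_laplace[OF k bound' F that] by blast+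
  have shift: "(deriv ^^ n) (deriv F) = (deriv ^^ Suc n) F" for n
    by (simp add: funpow_swap1)
  have smooth: "smooth_pos F"
    unfolding smooth_pos_def
    by (intro allI differentiable_at_imp_differentiable_on)
       (use deriv(2) in \<open>auto simp: field_differentiable_imp_differentiable\<close>)
  have cm: "(-1) ^ n * (deriv ^^ n) (deriv F) x \<ge> 0" if "x > 0" for n x
  proof -
    have "(-1) ^ n * (deriv ^^ n) (deriv F) x
        = real (Suc n) * laplace_moment k n x - x * laplace_moment k (Suc n) x"
      unfolding shift deriv(1)[OF that]
      by (simp add: algebra_simps flip: power_mult_distrib)
    thus ?thesis using laplace_of_antimono_kernel[OF k bound' that anti] by simp
  qed
  have "F x \<ge> 0" if "x > 0" for x
  proof -
    have "0 \<le> indicator {0<..} t * (t ^ 0 * exp (- (x * t)) * k t)" for t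
      using nonneg[of t] by (cases "t > 0") auto
    hence "laplace_moment k 0 x \<ge> 0"
      unfolding laplace_moment_def by (intro integral_nonneg_AE AE_I2)
    thus ?thesis using that by (simp add: F)
  qed
  moreover have "smooth_pos (deriv F)"
    using smooth unfolding smooth_pos_def shift by blast
  moreover have "deriv F x \<ge> 0" if "x > 0" for x
    using cm[OF that, of 0] by simp
  ultimately show ?thesis
    using smooth cm by (auto simp: bernstein_function_def completely_monotone_def)
qed

text \<open>
  For the parameters \<open>0\<close> and \<open>1\<close> of the Gamma ratio: there one of the two integrals behind the
  general kernel diverges, but the ratio is constant and the kernel can be taken constant too.
\<close>

lemma bernstein_functionI_const:
  assumes "\<And>x. x > 0 \<Longrightarrow> F x = c" "c \<ge> 0"
  shows "bernstein_function F"
proof (rule bernstein_functionI_laplace[where k = "\<lambda>_. c" and B = c])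
  fix x :: real assume x: "x > 0"
  have "laplace_moment (\<lambda>_. c) 0 x = c / x"
    using has_bochner_integral_mult_left[OF has_bochner_integral_power_exp[OF x, of 0], of c]
    by (auto simp: laplace_moment_def has_bochner_integral_iff mult_ac)
  thus "F x = x * laplace_moment (\<lambda>_. c) 0 x" using assms(1)[OF x] x by simp
qed (use assms in \<open>auto intro!: monotone_onI\<close>)

section \<open>The Gamma ratio as the Laplace transform of a decreasing kernel\<close>

text \<open>
  Euler's Beta integral after the substitution of \<open>exp (- s)\<close> for its variable.
\<close>

lemma nn_integral_exp_eq_Beta:
  fixes a b :: real
  assumes "a > 0" "b > 0"
  shows "(\<integral>\<^sup>+s. ennreal (indicator {0<..} s * (exp (- (a * s)) * (1 - exp (- s)) powr (b - 1))) \<partial>lborel)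
           = ennreal (Beta a b)"
proof -
  let ?f = "\<lambda>t::real. t powr (a - 1) * (1 - t) powr (b - 1)"
  let ?g = "\<lambda>s::real. exp (- s)"
  let ?h = "\<lambda>s. \<bar>- exp (- s)\<bar> * ?f (?g s)"
  have range: "?g ` {0<..} = {0<..<1}"
  proof (intro equalityI subsetI)
    fix t :: real assume "t \<in> {0<..<1}"
    thus "t \<in> ?g ` {0<..}" by (intro image_eqI[of _ _ "- ln t"]) auto
  qed auto
  have "(?f has_integral Beta a b) {0<..<1}"
    using has_integral_Beta_real[OF assms] by (simp add: has_integral_Icc_iff_Ioo)
  hence "?f absolutely_integrable_on {0<..<1} \<and> integral {0<..<1} ?f = Beta a b"
    by (auto intro!: nonnegative_absolutely_integrable_1 simp: has_integral_iff)
  hence "?h absolutely_integrable_on {0<..} \<and> integral {0<..} ?h = Beta a b"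
    by (subst has_absolute_integral_change_of_variables_1')
       (auto simp: range inj_on_def intro!: derivative_eq_intros)
  hence "(?h has_integral Beta a b) {0<..}"
    using set_lebesgue_integral_eq_integral(1) by (auto simp: has_integral_iff)
  hence "(\<integral>\<^sup>+s. ennreal (indicator {0<..} s * ?h s) \<partial>lborel) = ennreal (Beta a b)"
    by (intro nn_integral_has_integral_lebesgue) auto
  also have "(\<lambda>s. indicator {0<..} s * ?h s)
      = (\<lambda>s. indicator {0<..} s * (exp (- (a * s)) * (1 - exp (- s)) powr (b - 1)))"
    by (auto simp: fun_eq_iff indicator_def exp_powr_real algebra_simps simp flip: exp_add)
  finally show ?thesis .
qed

lemma nn_integral_convolution:
  fixes f g :: "real \<Rightarrow> ennreal"
  assumes [measurable]: "f \<in> borel_measurable borel" "g \<in> borel_measurable borel"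
  shows "(\<integral>\<^sup>+t. f t \<partial>lborel) * (\<integral>\<^sup>+s. g s \<partial>lborel)
           = (\<integral>\<^sup>+t. (\<integral>\<^sup>+s. f (t - s) * g s \<partial>lborel) \<partial>lborel)"
proof -
  have "(\<integral>\<^sup>+t. (\<integral>\<^sup>+s. f (t - s) * g s \<partial>lborel) \<partial>lborel)
      = (\<integral>\<^sup>+s. (\<integral>\<^sup>+t. f (t - s) * g s \<partial>lborel) \<partial>lborel)"
    by (rule lborel_pair.Fubini') measurable
  also have "\<dots> = (\<integral>\<^sup>+s. (\<integral>\<^sup>+t. f t \<partial>lborel) * g s \<partial>lborel)"
  proof (rule nn_integral_cong)
    fix s :: real
    have "(\<integral>\<^sup>+t. f t \<partial>lborel) = (\<integral>\<^sup>+t. f (t - s) \<partial>lborel)"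
      using nn_integral_real_affine[of f 1 "- s"] by (simp add: algebra_simps)
    thus "(\<integral>\<^sup>+t. f (t - s) * g s \<partial>lborel) = (\<integral>\<^sup>+t. f t \<partial>lborel) * g s"
      by (subst nn_integral_multc) auto
  qed
  also have "\<dots> = (\<integral>\<^sup>+t. f t \<partial>lborel) * (\<integral>\<^sup>+s. g s \<partial>lborel)"
    by (subst nn_integral_cmult) auto
  finally show ?thesis ..
qed

text \<open>
  The chord slope \<open>(exp s - 1) / s\<close> of the convex function \<open>exp\<close> is increasing.
\<close>

lemma div_exp_minus_one_antimono:
  fixes s t :: real
  assumes "0 < s" "s \<le> t"
  shows "t / (exp t - 1) \<le> s / (exp s - 1)"
proof -
  have "exp ((1 - s / t) *\<^sub>R 0 + (s / t) *\<^sub>R t) \<le> (1 - s / t) * exp 0 + (s / t) * exp t"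
    using assms by (intro convex_onD[OF exp_convex]) auto
  hence "t * (exp s - 1) \<le> s * (exp t - 1)"
    using assms by (simp add: divide_simps) (simp add: algebra_simps)
  thus ?thesis using assms by (simp add: field_simps)
qed

lemma div_exp_minus_one_le_one:
  fixes s :: real
  assumes "s > 0"
  shows "s / (exp s - 1) \<le> 1"
  using exp_ge_add_one_self[of s] assms by (subst divide_le_eq_1_pos) linarith+

text \<open>
  Up to normalisation, the density of the Beta distribution with parameters \<open>1 - \<alpha>\<close> and \<open>\<alpha>\<close>.
\<close>

definition beta_weight :: "real \<Rightarrow> real \<Rightarrow> real" where
  "beta_weight \<alpha> u = indicator {0<..<1} u * (u powr (- \<alpha>) * (1 - u) powr (\<alpha> - 1))"

text \<open>
  The expectation of \<open>\<phi> (t * U)\<close>, where \<open>\<phi> s = (s / (exp s - 1)) powr \<alpha>\<close> and \<open>U\<close> has the Beta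
  distribution above. In this form the kernel visibly inherits monotonicity and the bound \<open>1\<close>
  from \<open>\<phi>\<close>, which the convolution it comes from does not show.
\<close>

definition ratio_kernel :: "real \<Rightarrow> real \<Rightarrow> real" where
  "ratio_kernel \<alpha> t =
     (\<integral>u. beta_weight \<alpha> u * (t * u / (exp (t * u) - 1)) powr \<alpha> \<partial>lborel) / Beta (1 - \<alpha>) \<alpha>"

lemma beta_weight_nonneg: "beta_weight \<alpha> u \<ge> 0"
  by (simp add: beta_weight_def)

lemma borel_measurable_beta_weight [measurable]: "beta_weight \<alpha> \<in> borel_measurable borel"
  unfolding beta_weight_def by measurable

lemma has_bochner_integral_beta_weight:
  assumes "0 < \<alpha>" "\<alpha> < 1"
  shows "has_bochner_integral lborel (beta_weight \<alpha>) (Beta (1 - \<alpha>) \<alpha>)"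
proof (rule has_bochner_integral_nn_integral)
  have "((\<lambda>t. t powr (- \<alpha>) * (1 - t) powr (\<alpha> - 1)) has_integral Beta (1 - \<alpha>) \<alpha>) {0<..<1}"
    using has_integral_Beta_real[of "1 - \<alpha>" \<alpha>] assms by (simp add: has_integral_Icc_iff_Ioo)
  thus "(\<integral>\<^sup>+u. ennreal (beta_weight \<alpha> u) \<partial>lborel) = ennreal (Beta (1 - \<alpha>) \<alpha>)"
    unfolding beta_weight_def by (intro nn_integral_has_integral_lebesgue) auto
qed (use assms in \<open>auto simp: beta_weight_nonneg Beta_def intro!: divide_nonneg_pos mult_nonneg_nonneg Gamma_real_pos less_imp_le\<close>)

context
  fixes \<alpha> :: real
  assumes \<alpha>: "0 < \<alpha>" "\<alpha> < 1"
begin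

lemma Beta_pos: "Beta (1 - \<alpha>) \<alpha> > 0"
  using \<alpha> by (simp add: Beta_def Gamma_real_pos)

lemma ratio_kernel_integrand_le:
  assumes "0 < t"
  shows "beta_weight \<alpha> u * (t * u / (exp (t * u) - 1)) powr \<alpha> \<le> beta_weight \<alpha> u"
proof (cases "u \<in> {0<..<1}")
  case True
  hence "(t * u / (exp (t * u) - 1)) powr \<alpha> \<le> 1 powr \<alpha>"
    using assms \<alpha> by (intro powr_mono2 div_exp_minus_one_le_one) auto
  thus ?thesis
    using beta_weight_nonneg[of \<alpha> u] by (intro mult_left_le) auto
qed (simp add: beta_weight_def)

lemma ratio_kernel_integrable:
  assumes "0 < t"
  shows "integrable lborel (\<lambda>u. beta_weight \<alpha> u * (t * u / (exp (t * u) - 1)) powr \<alpha>)"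
proof (rule Bochner_Integration.integrable_bound)
  show "integrable lborel (beta_weight \<alpha>)"
    using has_bochner_integral_beta_weight[OF \<alpha>] by (simp add: has_bochner_integral_iff)
  show "AE u in lborel. norm (beta_weight \<alpha> u * (t * u / (exp (t * u) - 1)) powr \<alpha>)
          \<le> norm (beta_weight \<alpha> u)"
    using ratio_kernel_integrand_le[OF assms] by (simp add: abs_mult beta_weight_nonneg)
qed measurable

lemma ratio_kernel_nonneg: "ratio_kernel \<alpha> t \<ge> 0"
  unfolding ratio_kernel_def using Beta_pos
  by (intro divide_nonneg_pos integral_nonneg_AE) (auto simp: beta_weight_nonneg)

lemma ratio_kernel_le_one:
  assumes "0 < t"
  shows "ratio_kernel \<alpha> t \<le> 1"
proof -
  have "(\<integral>u. beta_weight \<alpha> u * (t * u / (exp (t * u) - 1)) powr \<alpha> \<partial>lborel)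
          \<le> (\<integral>u. beta_weight \<alpha> u \<partial>lborel)"
    using has_bochner_integral_beta_weight[OF \<alpha>] ratio_kernel_integrand_le[OF assms]
    by (intro integral_mono ratio_kernel_integrable assms) (auto simp: has_bochner_integral_iff)
  thus ?thesis
    using has_bochner_integral_beta_weight[OF \<alpha>] Beta_pos
    by (simp add: ratio_kernel_def has_bochner_integral_iff)
qed

lemma ratio_kernel_antimono: "antimono_on {0<..} (ratio_kernel \<alpha>)"
proof (rule monotone_onI)
  fix s t :: real
  assume st: "s \<in> {0<..}" "t \<in> {0<..}" "s \<le> t"
  have "beta_weight \<alpha> u * (t * u / (exp (t * u) - 1)) powr \<alpha>
          \<le> beta_weight \<alpha> u * (s * u / (exp (s * u) - 1)) powr \<alpha>" for u
  proof (cases "u \<in> {0<..<1}")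
    case True
    thus ?thesis using st \<alpha>
      by (intro mult_left_mono powr_mono2 div_exp_minus_one_antimono beta_weight_nonneg) auto
  qed (simp add: beta_weight_def)
  thus "ratio_kernel \<alpha> s \<ge> ratio_kernel \<alpha> t"
    using st Beta_pos unfolding ratio_kernel_def
    by (intro divide_right_mono integral_mono ratio_kernel_integrable) auto
qed

lemma borel_measurable_ratio_kernel [measurable]: "ratio_kernel \<alpha> \<in> borel_measurable borel"
  unfolding ratio_kernel_def by measurable

text \<open>
  The right-hand side, apart from its denominator, is a product of two Laplace transforms: a Gamma
  integral for \<open>Gamma \<alpha> / x powr \<alpha>\<close>, and for the Beta factor that of \<open>(exp s - 1) powr (- \<alpha>)\<close>.
  The product is the transform of the convolution. Scaling its inner variable, \<open>s = t * u\<close>, makes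
  the powers of \<open>t\<close> combine to \<open>t powr \<alpha>\<close>, which completes \<open>(exp (t * u) - 1) powr (- \<alpha>)\<close> to
  \<open>u powr (- \<alpha>) * \<phi> (t * u)\<close>: the integrand of the kernel.
\<close>

lemma Gamma_integral_product_eq_laplace:
  assumes x: "x > 0"
  shows "laplace_moment (ratio_kernel \<alpha>) 0 x
           = Gamma \<alpha> / x powr \<alpha> * Beta (x + \<alpha>) (1 - \<alpha>) / Beta (1 - \<alpha>) \<alpha>"
proof -
  define f where "f = (\<lambda>t::real. ennreal (indicator {0<..} t * (t powr (\<alpha> - 1) * exp (- (x * t)))))"
  \<comment> \<open>On positive \<open>s\<close> this is \<open>exp (- (x * s)) * (exp s - 1) powr (- \<alpha>)\<close>, written as in the Beta integral.\<close>
  define g where "g = (\<lambda>s::real. ennreal (indicator {0<..} s *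
      (exp (- ((x + \<alpha>) * s)) * (1 - exp (- s)) powr (1 - \<alpha> - 1))))"
  define K where "K = (\<lambda>t. ratio_kernel \<alpha> t * Beta (1 - \<alpha>) \<alpha>)"
  have [measurable]: "f \<in> borel_measurable borel" "g \<in> borel_measurable borel"
    unfolding f_def g_def by measurable
  have K: "(\<integral>\<^sup>+u. ennreal (beta_weight \<alpha> u * (t * u / (exp (t * u) - 1)) powr \<alpha>) \<partial>lborel)
              = ennreal (K t)" if "t > 0" for t
    unfolding K_def ratio_kernel_def using Beta_pos
    by (subst nn_integral_eq_integral[OF ratio_kernel_integrable[OF that]])
       (auto simp: beta_weight_nonneg)
  have conv: "(\<integral>\<^sup>+s. f (t - s) * g s \<partial>lborel)
                = ennreal (indicator {0<..} t * (t ^ 0 * exp (- (x * t)) * K t))" for t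
  proof (cases "t > 0")
    case t: True
    have "(\<integral>\<^sup>+s. f (t - s) * g s \<partial>lborel)
            = ennreal \<bar>t\<bar> * (\<integral>\<^sup>+u. f (t - (0 + t * u)) * g (0 + t * u) \<partial>lborel)"
      using t by (intro nn_integral_real_affine) auto
    also have "\<dots> = (\<integral>\<^sup>+u. ennreal t * (f (t - t * u) * g (t * u)) \<partial>lborel)"
      using t by (subst nn_integral_cmult) auto
    also have "\<dots> = (\<integral>\<^sup>+u. ennreal (exp (- (x * t))) *
        ennreal (beta_weight \<alpha> u * (t * u / (exp (t * u) - 1)) powr \<alpha>) \<partial>lborel)"
    proof (rule nn_integral_cong)
      fix u :: real
      show "ennreal t * (f (t - t * u) * g (t * u)) = ennreal (exp (- (x * t))) *
              ennreal (beta_weight \<alpha> u * (t * u / (exp (t * u) - 1)) powr \<alpha>)"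
      proof (cases "u \<in> {0<..<1}")
        case u: True
        define E where "E = exp (t * u) - 1"
        have E: "E > 0" using t u by (simp add: E_def)
        have tu: "t - t * u = t * (1 - u)" by (simp add: algebra_simps)
        have "1 - exp (- (t * u)) = exp (- (t * u)) * E"
          by (simp add: E_def algebra_simps flip: exp_add)
        hence "(1 - exp (- (t * u))) powr (- \<alpha>) = exp (\<alpha> * (t * u)) * E powr (- \<alpha>)"
          using E by (simp add: powr_mult exp_powr_real mult.commute)
        hence "g (t * u) = ennreal ((exp (- ((x + \<alpha>) * (t * u))) * exp (\<alpha> * (t * u))) * E powr (- \<alpha>))"
          using t u by (simp add: g_def)
        also have "exp (- ((x + \<alpha>) * (t * u))) * exp (\<alpha> * (t * u)) = exp (- (x * (t * u)))"
          by (simp add: mult_exp_exp distrib_right)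
        finally have g: "g (t * u) = ennreal (exp (- (x * (t * u))) * E powr (- \<alpha>))" .
        have f: "f (t - t * u) = ennreal (t powr (\<alpha> - 1) * (1 - u) powr (\<alpha> - 1) * exp (- (x * (t * (1 - u)))))"
          unfolding tu f_def using t u by (simp add: powr_mult)
        have "t * (t powr (\<alpha> - 1) * (1 - u) powr (\<alpha> - 1) * exp (- (x * (t * (1 - u))))
                * (exp (- (x * (t * u))) * E powr (- \<alpha>)))
            = (t * t powr (\<alpha> - 1)) * (exp (- (x * (t * (1 - u)))) * exp (- (x * (t * u))))
                * ((1 - u) powr (\<alpha> - 1) * E powr (- \<alpha>))"
          by (simp add: mult_ac)
        also have "t * t powr (\<alpha> - 1) = t powr \<alpha>"
          using t by (simp add: powr_mult_base)
        also have "exp (- (x * (t * (1 - u)))) * exp (- (x * (t * u))) = exp (- (x * t))"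
          by (simp add: mult_exp_exp algebra_simps)
        also have "t powr \<alpha> * exp (- (x * t)) * ((1 - u) powr (\<alpha> - 1) * E powr (- \<alpha>))
            = exp (- (x * t)) * (beta_weight \<alpha> u * (t * u / E) powr \<alpha>)"
          using t u E by (simp add: beta_weight_def powr_mult powr_divide powr_minus field_simps)
        finally show ?thesis
          unfolding f g E_def using t
          by (simp add: ennreal_mult'[symmetric] ennreal_mult''[symmetric] beta_weight_nonneg)
      next
        case False
        hence "t * u \<le> 0 \<or> t - t * u \<le> 0"
          using t by (auto simp: mult_le_0_iff not_less)
        thus ?thesis using False by (auto simp: f_def g_def beta_weight_def)
      qed
    qed
    also have "\<dots> = ennreal (exp (- (x * t))) * ennreal (K t)"
      by (subst nn_integral_cmult) (auto simp: K[OF t])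
    finally show ?thesis using t by (simp add: ennreal_mult')
  next
    case False
    hence "(\<lambda>s. f (t - s) * g s) = (\<lambda>_. 0)" by (auto simp: f_def g_def indicator_def)
    thus ?thesis using False by (simp only:) simp
  qed
  have "ennreal (Gamma \<alpha> / x powr \<alpha>) * ennreal (Beta (x + \<alpha>) (1 - \<alpha>))
          = (\<integral>\<^sup>+t. f t \<partial>lborel) * (\<integral>\<^sup>+s. g s \<partial>lborel)"
    unfolding f_def g_def using \<alpha> x
    by (subst nn_integral_powr_exp, simp, simp, subst nn_integral_exp_eq_Beta) auto
  also have "\<dots> = (\<integral>\<^sup>+t. ennreal (indicator {0<..} t * (t ^ 0 * exp (- (x * t)) * K t)) \<partial>lborel)"
    by (subst nn_integral_convolution) (auto simp: conv)
  finally have "has_bochner_integral lborel (\<lambda>t. indicator {0<..} t * (t ^ 0 * exp (- (x * t)) * K t))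
      (Gamma \<alpha> / x powr \<alpha> * Beta (x + \<alpha>) (1 - \<alpha>))"
    using \<alpha> x Beta_pos
    by (intro has_bochner_integral_nn_integral)
       (auto simp: ennreal_mult'[symmetric] K_def ratio_kernel_nonneg Beta_def Gamma_real_pos less_imp_le)
  hence "(\<integral>t. indicator {0<..} t * (t ^ 0 * exp (- (x * t)) * ratio_kernel \<alpha> t) * Beta (1 - \<alpha>) \<alpha> \<partial>lborel)
      = Gamma \<alpha> / x powr \<alpha> * Beta (x + \<alpha>) (1 - \<alpha>)"
    by (simp add: has_bochner_integral_iff K_def mult_ac)
  thus ?thesis
    using Beta_pos unfolding integral_mult_left_zero laplace_moment_def[symmetric]
    by (subst nonzero_eq_divide_eq) auto
qed

lemma gamma_ratio_eq_laplace:
  assumes x: "x > 0"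
  shows "gamma_ratio \<alpha> x = x * laplace_moment (ratio_kernel \<alpha>) 0 x"
proof -
  have "Gamma (x + 1) = x * Gamma x"
    using x by (intro Gamma_plus1) auto
  moreover have "Gamma (1 - \<alpha>) > 0" "Gamma \<alpha> > 0" "Gamma x > 0"
    using \<alpha> x by (auto intro: Gamma_real_pos)
  ultimately show ?thesis
    unfolding Gamma_integral_product_eq_laplace[OF x] gamma_ratio_def using x
    by (simp add: Beta_def field_simps)
qed

lemma bernstein_gamma_ratio: "bernstein_function (gamma_ratio \<alpha>)"
  by (rule bernstein_functionI_laplace[where k = "ratio_kernel \<alpha>" and B = 1])
     (auto intro: ratio_kernel_nonneg ratio_kernel_le_one ratio_kernel_antimono gamma_ratio_eq_laplace)

end

section \<open>Blow-up at zero for large parameters\<close>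

lemma bernstein_function_mono:
  assumes "bernstein_function g" "0 < x" "x \<le> y"
  shows "g x \<le> g y"
proof (rule DERIV_nonneg_imp_nondecreasing[OF \<open>x \<le> y\<close>])
  fix z assume "x \<le> z" "z \<le> y"
  hence z: "z > 0" using assms by auto
  have "(deriv ^^ 0) g differentiable_on {0<..}"
    using assms(1) unfolding bernstein_function_def smooth_pos_def by blast
  hence "g differentiable (at z)"
    using z by (simp add: differentiable_on_eq_differentiable_at)
  hence "(g has_real_derivative deriv g z) (at z)"
    by (simp add: DERIV_deriv_iff_real_differentiable)
  moreover have "deriv g z \<ge> 0"
    using assms(1) z unfolding bernstein_function_def completely_monotone_def by auto
  ultimately show "\<exists>y. (g has_real_derivative y) (at z) \<and> 0 \<le> y" by blast
qed

text \<open>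
  Since \<open>Gamma (x + 1) = x * Gamma x\<close>, the ratio behaves like \<open>Gamma \<alpha> * x powr (1 - \<alpha>)\<close> near
  zero, with a negative exponent.
\<close>

lemma gamma_ratio_at_right_0:
  assumes "\<alpha> > 1"
  shows "filterlim (gamma_ratio \<alpha>) at_top (at_right 0)"
proof -
  have "((\<lambda>x. Gamma (x + \<alpha>) / Gamma (x + 1)) \<longlongrightarrow> Gamma (0 + \<alpha>) / Gamma (0 + 1)) (at_right 0)"
    using assms by (intro tendsto_intros) auto
  moreover have "Gamma (0 + \<alpha>) / Gamma (0 + 1) > 0"
    using assms by (simp add: Gamma_real_pos)
  moreover have "filterlim (\<lambda>x::real. x powr (1 - \<alpha>)) at_top (at_right 0)"
  proof -
    have "filterlim (\<lambda>x::real. - ln x) at_top (at_right 0)"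
      using ln_at_0 by (simp add: filterlim_uminus_at_bot)
    hence "filterlim (\<lambda>x::real. (\<alpha> - 1) * - ln x) at_top (at_right 0)"
      using assms by (intro filterlim_tendsto_pos_mult_at_top[OF tendsto_const]) auto
    hence "filterlim (\<lambda>x::real. exp ((\<alpha> - 1) * - ln x)) at_top (at_right 0)"
      by (rule filterlim_compose[OF exp_at_top])
    thus ?thesis
      by (rule filterlim_cong[THEN iffD1, OF refl refl, rotated])
         (auto simp: powr_def eventually_at_filter algebra_simps)
  qed
  ultimately have "filterlim (\<lambda>x. Gamma (x + \<alpha>) / Gamma (x + 1) * x powr (1 - \<alpha>)) at_top (at_right 0)"
    by (rule filterlim_tendsto_pos_mult_at_top)
  moreover have "Gamma (x + \<alpha>) / Gamma (x + 1) * x powr (1 - \<alpha>) = gamma_ratio \<alpha> x" if "x > 0" for x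
  proof -
    have "Gamma (x + 1) = x * Gamma x" using that by (intro Gamma_plus1) auto
    thus ?thesis using that by (simp add: gamma_ratio_def powr_diff)
  qed
  hence "eventually (\<lambda>x. Gamma (x + \<alpha>) / Gamma (x + 1) * x powr (1 - \<alpha>) = gamma_ratio \<alpha> x) (at_right 0)"
    by (auto simp: eventually_at_filter)
  ultimately show ?thesis
    by (rule filterlim_cong[THEN iffD1, OF refl refl, rotated])
qed

lemma bernstein_gamma_ratio_imp_le_one:
  assumes "bernstein_function (gamma_ratio \<alpha>)"
  shows "\<alpha> \<le> 1"
proof (rule ccontr)
  assume "\<not> \<alpha> \<le> 1"
  hence "eventually (\<lambda>x. gamma_ratio \<alpha> x > gamma_ratio \<alpha> 1) (at_right 0)"
    using gamma_ratio_at_right_0[of \<alpha>] by (simp add: filterlim_at_top_dense)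
  moreover have "eventually (\<lambda>x. x \<in> {0<..<1}) (at_right (0::real))"
    by (rule eventually_at_right_real) auto
  ultimately have "eventually (\<lambda>x::real. False) (at_right 0)"
  proof eventually_elim
    case (elim x)
    thus ?case using bernstein_function_mono[OF assms, of x 1] by auto
  qed
  thus False by (simp add: trivial_limit_at_right_real)
qed

section \<open>The characterisation\<close>

theorem theorem3p3:
  fixes \<alpha> :: real
  assumes "\<alpha> \<ge> 0"
  shows "bernstein_function (gamma_ratio \<alpha>) \<longleftrightarrow> 0 \<le> \<alpha> \<and> \<alpha> \<le> 1"
proof
  assume "bernstein_function (gamma_ratio \<alpha>)"
  thus "0 \<le> \<alpha> \<and> \<alpha> \<le> 1"
    using assms bernstein_gamma_ratio_imp_le_one by blast
next
  assume "0 \<le> \<alpha> \<and> \<alpha> \<le> 1"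
  then consider "\<alpha> = 0" | "\<alpha> = 1" | "0 < \<alpha>" "\<alpha> < 1" by linarith
  thus "bernstein_function (gamma_ratio \<alpha>)"
  proof cases
    case 1
    hence "gamma_ratio \<alpha> x = 1" if "x > 0" for x
      using that less_imp_neq[OF Gamma_real_pos[OF that]] by (simp add: gamma_ratio_def)
    thus ?thesis by (rule bernstein_functionI_const) auto
  next
    case 2
    have "gamma_ratio \<alpha> x = 1" if "x > 0" for x
    proof -
      have "Gamma (x + 1) = x * Gamma x" using that by (intro Gamma_plus1) auto
      thus ?thesis using that less_imp_neq[OF Gamma_real_pos[OF that]] 2 by (simp add: gamma_ratio_def)
    qed
    thus ?thesis by (rule bernstein_functionI_const) auto
  next
    case 3
    thus ?thesis by (rule bernstein_gamma_ratio)
  qed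
qed

end
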